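(* Let $(M,\varphi,\xi,\eta,g)$ be a $(2n+1)$-dimensional almost contact manifold with Norden metric, with Levi-Civita connection $\nabla$ of $g$. For arbitrary real numbers $t_1,\dots,t_{10}$ let $\nabla'$ be the linear connection defined by $g(\nabla'_xy-\nabla_xy,z)=Q(x,y,z)$, where $$ \begin{aligned} Q(x,y,z)&=\tfrac12\{F(x,\varphi y,z)+F(x,\varphi y,\xi)\eta(z)\}-F(x,\varphi z,\xi)\eta(y)\\ &+t_1\{F(y,x,z)+F(\varphi y,\varphi x,z)-F(y,x,\xi)\eta(z)-F(\varphi y,\varphi x,\xi)\eta(z)\\ &\qquad-F(y,z,\xi)\eta(x)-F(\xi,x,z)\eta(y)+\eta(x)\eta(y)\omega(z)\}\\ &+t_2\{F(z,x,y)+F(\varphi z,\varphi x,y)-F(z,x,\xi)\eta(y)-F(\varphi z,\varphi x,\xi)\eta(y)\\ &\qquad-F(z,y,\xi)\eta(x)-F(\xi,x,y)\eta(z)+\eta(x)\eta(z)\omega(y)\}\\ &+t_3\{F(y,\varphi x,z)-F(\varphi y,x,z)-F(y,\varphi x,\xi)\eta(z)+F(\varphi y,x,\xi)\eta(z)\\ &\qquad-F(y,\varphi z,\xi)\eta(x)-F(\xi,\varphi x,z)\eta(y)+\eta(x)\eta(y)\omega(\varphi z)\}\\ &+t_4\{F(z,\varphi x,y)-F(\varphi z,x,y)-F(z,\varphi x,\xi)\eta(y)+F(\varphi z,x,\xi)\eta(y)\\ &\qquad-F(z,\varphi y,\xi)\eta(x)-F(\xi,\varphi x,y)\eta(z)+\eta(x)\eta(z)\omega(\varphi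 y)\}\\ &+t_5\{F(\varphi y,z,\xi)+F(y,\varphi z,\xi)-\eta(y)\omega(\varphi z)\}\eta(x)\\ &+t_6\{F(\varphi z,y,\xi)+F(z,\varphi y,\xi)-\omega(\varphi y)\eta(z)\}\eta(x)\\ &+t_7\{F(\varphi y,\varphi z,\xi)-F(y,z,\xi)+\eta(y)\omega(z)\}\eta(x)\\ &+t_8\{F(\varphi z,\varphi y,\xi)-F(z,y,\xi)+\omega(y)\eta(z)\}\eta(x)\\ &+t_9\,\omega(x)\eta(y)\eta(z)+t_{10}\,\omega(\varphi x)\eta(y)\eta(z) \end{aligned} $$ for all vector fields $x,y,z$ on $M$. Then $\nabla'$ is an almost $\varphi$-connection, i.e. $\nabla'\varphi=0$, for every choice of $(t_1,\dots,t_{10})\in\mathbb{R}^{10}$.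
   Context: An almost contact manifold with Norden metric $(M,\varphi,\xi,\eta,g)$ is a smooth $(2n+1)$-dimensional manifold $M$ with an endomorphism $\varphi$ of the tangent bundle, a vector field $\xi$, a 1-form $\eta$ and a pseudo-Riemannian metric $g$ such that $\varphi^2x=-x+\eta(x)\xi$, $\eta(\xi)=1$, $g(\varphi x,\varphi y)=-g(x,y)+\eta(x)\eta(y)$ for all vector fields $x,y$. (Consequently $\varphi\xi=0$, $\eta\circ\varphi=0$, $\eta(x)=g(x,\xi)$, $g(\varphi x,y)=g(x,\varphi y)$.) The fundamental tensor is $F(x,y,z)=g((\nabla_x\varphi)y,z)$, where $\nabla$ is the Levi-Civita connection of $g$, and $\omega(x)=F(\xi,\xi,x)$. A linear connection $\nabla'$ is called an almost $\varphi$-connection if $\nabla'\varphi=0$. *)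

theory Defs
  imports "HOL-Analysis.Analysis"
begin

section \<open>Smooth maps between Euclidean spaces\<close>

primrec Ck_on :: "nat \<Rightarrow> ('a::euclidean_space \<Rightarrow> 'b::real_normed_vector) \<Rightarrow> 'a set \<Rightarrow> bool" where
  "Ck_on 0 f S \<longleftrightarrow> continuous_on S f"
| "Ck_on (Suc k) f S \<longleftrightarrow> (\<forall>x\<in>S. f differentiable (at x)) \<and>
     (\<forall>h. Ck_on k (\<lambda>x. frechet_derivative f (at x) h) S)"

text \<open>Only used for open \<open>S\<close>.\<close>

definition smooth_on :: "('a::euclidean_space \<Rightarrow> 'b::real_normed_vector) \<Rightarrow> 'a set \<Rightarrow> bool" where
  "smooth_on f S \<longleftrightarrow> (\<forall>k. Ck_on k f S)"


section \<open>Smooth manifolds\<close>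

text \<open>
  The manifold \<open>M\<close> is the whole type \<open>'m\<close>, which is Hausdorff and second countable by its type
  classes; its dimension is \<open>DIM('e)\<close>. A chart \<open>(U, \<kappa>)\<close> has domain \<open>U\<close>; the values of \<open>\<kappa>\<close> outside
  \<open>U\<close> are irrelevant. The atlas need not be maximal: it induces the same smooth functions and
  tangent vectors as the maximal atlas containing it.
\<close>

type_synonym ('m, 'e) atlas = "('m set \<times> ('m \<Rightarrow> 'e)) set"

definition smooth_atlas ::
    "('m::{t2_space,second_countable_topology}, 'e::euclidean_space) atlas \<Rightarrow> bool" where
  "smooth_atlas A \<longleftrightarrow>
     (\<forall>(U, \<kappa>)\<in>A. open U \<and> open (\<kappa> ` U) \<and> homeomorphism U (\<kappa> ` U) \<kappa> (inv_into U \<kappa>)) \<and>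
     (\<Union>(U, \<kappa>)\<in>A. U) = UNIV \<and>
     (\<forall>(U, \<kappa>)\<in>A. \<forall>(V, \<kappa>')\<in>A. smooth_on (\<kappa>' \<circ> inv_into U \<kappa>) (\<kappa> ` (U \<inter> V)))"

definition smooth_fun ::
    "('m::topological_space, 'e::euclidean_space) atlas \<Rightarrow> ('m \<Rightarrow> real) \<Rightarrow> bool" where
  "smooth_fun A f \<longleftrightarrow> (\<forall>(U, \<kappa>)\<in>A. smooth_on (f \<circ> inv_into U \<kappa>) (\<kappa> ` U))"

definition smooth_curve ::
    "('m::topological_space, 'e::euclidean_space) atlas \<Rightarrow> real \<Rightarrow> (real \<Rightarrow> 'm) \<Rightarrow> bool" where
  "smooth_curve A \<epsilon> \<gamma> \<longleftrightarrow> continuous_on {-\<epsilon><..<\<epsilon>} \<gamma> \<and>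
     (\<forall>(U, \<kappa>)\<in>A. smooth_on (\<kappa> \<circ> \<gamma>) {t\<in>{-\<epsilon><..<\<epsilon>}. \<gamma> t \<in> U})"

text \<open>
  Tangent vectors at \<open>p\<close> are the velocities at time \<open>0\<close> of smooth curves through \<open>p\<close>, regarded as
  functionals \<open>f \<mapsto> (f \<circ> \<gamma>)'(0)\<close> on smooth functions. They are set to \<open>0\<close> on non-smooth functions,
  so that tangent vectors agreeing on all smooth functions are equal in HOL.
\<close>

type_synonym 'm tvec = "('m \<Rightarrow> real) \<Rightarrow> real"

definition velocity ::
    "('m::topological_space, 'e::euclidean_space) atlas \<Rightarrow> (real \<Rightarrow> 'm) \<Rightarrow> 'm tvec" where
  "velocity A \<gamma> = (\<lambda>f. if smooth_fun A f then deriv (f \<circ> \<gamma>) 0 else 0)"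

definition tangent_space ::
    "('m::topological_space, 'e::euclidean_space) atlas \<Rightarrow> 'm \<Rightarrow> 'm tvec set" where
  "tangent_space A p = {velocity A \<gamma> | \<epsilon> \<gamma>. \<epsilon> > 0 \<and> smooth_curve A \<epsilon> \<gamma> \<and> \<gamma> 0 = p}"

definition tv_zero :: "'m tvec" where
  "tv_zero = (\<lambda>f. 0)"

definition tv_add :: "'m tvec \<Rightarrow> 'm tvec \<Rightarrow> 'm tvec" where
  "tv_add v w = (\<lambda>f. v f + w f)"

definition tv_scale :: "real \<Rightarrow> 'm tvec \<Rightarrow> 'm tvec" where
  "tv_scale c v = (\<lambda>f. c * v f)"


section \<open>Vector fields and tensor fields\<close>

type_synonym 'm vfield = "'m \<Rightarrow> 'm tvec"

definition vf_zero :: "'m vfield" where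
  "vf_zero = (\<lambda>p. tv_zero)"

definition vf_add :: "'m vfield \<Rightarrow> 'm vfield \<Rightarrow> 'm vfield" where
  "vf_add X Y = (\<lambda>p. tv_add (X p) (Y p))"

definition vf_scale :: "('m \<Rightarrow> real) \<Rightarrow> 'm vfield \<Rightarrow> 'm vfield" where
  "vf_scale u X = (\<lambda>p. tv_scale (u p) (X p))"

definition vf_diff :: "'m vfield \<Rightarrow> 'm vfield \<Rightarrow> 'm vfield" where
  "vf_diff X Y = vf_add X (vf_scale (\<lambda>p. - 1) Y)"

definition vf_map :: "('m \<Rightarrow> 'm tvec \<Rightarrow> 'm tvec) \<Rightarrow> 'm vfield \<Rightarrow> 'm vfield" where
  "vf_map \<phi> X = (\<lambda>p. \<phi> p (X p))"

definition vf_apply :: "'m vfield \<Rightarrow> ('m \<Rightarrow> real) \<Rightarrow> 'm \<Rightarrow> real" where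
  "vf_apply X f = (\<lambda>p. X p f)"

definition lie_bracket :: "'m vfield \<Rightarrow> 'm vfield \<Rightarrow> 'm vfield" where
  "lie_bracket X Y = (\<lambda>p f. X p (vf_apply Y f) - Y p (vf_apply X f))"

definition vector_field ::
    "('m::topological_space, 'e::euclidean_space) atlas \<Rightarrow> 'm vfield \<Rightarrow> bool" where
  "vector_field A X \<longleftrightarrow> (\<forall>p. X p \<in> tangent_space A p) \<and>
     (\<forall>f. smooth_fun A f \<longrightarrow> smooth_fun A (vf_apply X f))"

definition one_form ::
    "('m::topological_space, 'e::euclidean_space) atlas \<Rightarrow> ('m \<Rightarrow> 'm tvec \<Rightarrow> real) \<Rightarrow> bool" where
  "one_form A \<eta> \<longleftrightarrow>
     (\<forall>p. \<forall>v\<in>tangent_space A p. \<forall>w\<in>tangent_space A p. \<forall>a b.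
        \<eta> p (tv_add (tv_scale a v) (tv_scale b w)) = a * \<eta> p v + b * \<eta> p w) \<and>
     (\<forall>X. vector_field A X \<longrightarrow> smooth_fun A (\<lambda>p. \<eta> p (X p)))"

definition tangent_endomorphism ::
    "('m::topological_space, 'e::euclidean_space) atlas \<Rightarrow> ('m \<Rightarrow> 'm tvec \<Rightarrow> 'm tvec) \<Rightarrow> bool" where
  "tangent_endomorphism A \<phi> \<longleftrightarrow>
     (\<forall>p. \<forall>v\<in>tangent_space A p. \<phi> p v \<in> tangent_space A p) \<and>
     (\<forall>p. \<forall>v\<in>tangent_space A p. \<forall>w\<in>tangent_space A p. \<forall>a b.
        \<phi> p (tv_add (tv_scale a v) (tv_scale b w)) =
          tv_add (tv_scale a (\<phi> p v)) (tv_scale b (\<phi> p w))) \<and>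
     (\<forall>X. vector_field A X \<longrightarrow> vector_field A (vf_map \<phi> X))"

definition pseudo_riemannian_metric ::
    "('m::topological_space, 'e::euclidean_space) atlas \<Rightarrow>
     ('m \<Rightarrow> 'm tvec \<Rightarrow> 'm tvec \<Rightarrow> real) \<Rightarrow> bool" where
  "pseudo_riemannian_metric A g \<longleftrightarrow>
     (\<forall>p. \<forall>u\<in>tangent_space A p. \<forall>v\<in>tangent_space A p. \<forall>w\<in>tangent_space A p. \<forall>a b.
        g p (tv_add (tv_scale a u) (tv_scale b v)) w = a * g p u w + b * g p v w) \<and>
     (\<forall>p. \<forall>v\<in>tangent_space A p. \<forall>w\<in>tangent_space A p. g p v w = g p w v) \<and>
     (\<forall>p. \<forall>v\<in>tangent_space A p. (\<forall>w\<in>tangent_space A p. g p v w = 0) \<longrightarrow> v = tv_zero) \<and>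
     (\<forall>X Y. vector_field A X \<longrightarrow> vector_field A Y \<longrightarrow> smooth_fun A (\<lambda>p. g p (X p) (Y p)))"


section \<open>Linear connections\<close>

definition linear_connection ::
    "('m::topological_space, 'e::euclidean_space) atlas \<Rightarrow>
     ('m vfield \<Rightarrow> 'm vfield \<Rightarrow> 'm vfield) \<Rightarrow> bool" where
  "linear_connection A nabla \<longleftrightarrow>
     (\<forall>X Y. vector_field A X \<longrightarrow> vector_field A Y \<longrightarrow> vector_field A (nabla X Y)) \<and>
     (\<forall>X Y Z. vector_field A X \<longrightarrow> vector_field A Y \<longrightarrow> vector_field A Z \<longrightarrow>
        nabla (vf_add X Y) Z = vf_add (nabla X Z) (nabla Y Z) \<and>
        nabla X (vf_add Y Z) = vf_add (nabla X Y) (nabla X Z)) \<and>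
     (\<forall>u X Y. smooth_fun A u \<longrightarrow> vector_field A X \<longrightarrow> vector_field A Y \<longrightarrow>
        nabla (vf_scale u X) Y = vf_scale u (nabla X Y) \<and>
        nabla X (vf_scale u Y) = vf_add (vf_scale (vf_apply X u) Y) (vf_scale u (nabla X Y)))"

definition levi_civita ::
    "('m::topological_space, 'e::euclidean_space) atlas \<Rightarrow>
     ('m \<Rightarrow> 'm tvec \<Rightarrow> 'm tvec \<Rightarrow> real) \<Rightarrow> ('m vfield \<Rightarrow> 'm vfield \<Rightarrow> 'm vfield) \<Rightarrow> bool" where
  "levi_civita A g nabla \<longleftrightarrow> linear_connection A nabla \<and>
     (\<forall>X Y. vector_field A X \<longrightarrow> vector_field A Y \<longrightarrow>
        vf_diff (nabla X Y) (nabla Y X) = lie_bracket X Y) \<and>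
     (\<forall>X Y Z p. vector_field A X \<longrightarrow> vector_field A Y \<longrightarrow> vector_field A Z \<longrightarrow>
        vf_apply X (\<lambda>q. g q (Y q) (Z q)) p = g p (nabla X Y p) (Z p) + g p (Y p) (nabla X Z p))"

text \<open>\<open>(\<nabla>\<^sub>X \<phi>) Y = \<nabla>\<^sub>X (\<phi> Y) - \<phi> (\<nabla>\<^sub>X Y)\<close>\<close>

definition cov_deriv_endo ::
    "('m vfield \<Rightarrow> 'm vfield \<Rightarrow> 'm vfield) \<Rightarrow> ('m \<Rightarrow> 'm tvec \<Rightarrow> 'm tvec) \<Rightarrow>
     'm vfield \<Rightarrow> 'm vfield \<Rightarrow> 'm vfield" where
  "cov_deriv_endo nabla \<phi> X Y = vf_diff (nabla X (vf_map \<phi> Y)) (vf_map \<phi> (nabla X Y))"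


section \<open>Almost contact manifolds with Norden metric\<close>

definition almost_contact_norden ::
    "('m::topological_space, 'e::euclidean_space) atlas \<Rightarrow> ('m \<Rightarrow> 'm tvec \<Rightarrow> 'm tvec) \<Rightarrow>
     'm vfield \<Rightarrow> ('m \<Rightarrow> 'm tvec \<Rightarrow> real) \<Rightarrow> ('m \<Rightarrow> 'm tvec \<Rightarrow> 'm tvec \<Rightarrow> real) \<Rightarrow> bool" where
  "almost_contact_norden A \<phi> \<xi> \<eta> g \<longleftrightarrow>
     tangent_endomorphism A \<phi> \<and> vector_field A \<xi> \<and> one_form A \<eta> \<and> pseudo_riemannian_metric A g \<and>
     (\<forall>p. \<forall>v\<in>tangent_space A p.
        \<phi> p (\<phi> p v) = tv_add (tv_scale (- 1) v) (tv_scale (\<eta> p v) (\<xi> p))) \<and>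
     (\<forall>p. \<eta> p (\<xi> p) = 1) \<and>
     (\<forall>p. \<forall>v\<in>tangent_space A p. \<forall>w\<in>tangent_space A p.
        g p (\<phi> p v) (\<phi> p w) = - g p v w + \<eta> p v * \<eta> p w)"

definition fundamental_tensor ::
    "('m \<Rightarrow> 'm tvec \<Rightarrow> 'm tvec) \<Rightarrow> ('m \<Rightarrow> 'm tvec \<Rightarrow> 'm tvec \<Rightarrow> real) \<Rightarrow>
     ('m vfield \<Rightarrow> 'm vfield \<Rightarrow> 'm vfield) \<Rightarrow>
     'm vfield \<Rightarrow> 'm vfield \<Rightarrow> 'm vfield \<Rightarrow> 'm \<Rightarrow> real" where
  "fundamental_tensor \<phi> g nabla X Y Z p = g p (cov_deriv_endo nabla \<phi> X Y p) (Z p)"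

definition almost_phi_connection ::
    "('m::topological_space, 'e::euclidean_space) atlas \<Rightarrow> ('m \<Rightarrow> 'm tvec \<Rightarrow> 'm tvec) \<Rightarrow>
     ('m vfield \<Rightarrow> 'm vfield \<Rightarrow> 'm vfield) \<Rightarrow> bool" where
  "almost_phi_connection A \<phi> nabla \<longleftrightarrow> linear_connection A nabla \<and>
     (\<forall>X Y. vector_field A X \<longrightarrow> vector_field A Y \<longrightarrow> cov_deriv_endo nabla \<phi> X Y = vf_zero)"

text \<open>
  The value at the point \<open>p\<close> of the tensor \<open>Q(x, y, z)\<close>. The parameters are
  \<open>t 1, \<dots>, t 10\<close>; other values of \<open>t\<close> do not enter.
\<close>

definition Q_tensor ::
    "('m \<Rightarrow> 'm tvec \<Rightarrow> 'm tvec) \<Rightarrow> 'm vfield \<Rightarrow> ('m \<Rightarrow> 'm tvec \<Rightarrow> real) \<Rightarrow>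
     ('m \<Rightarrow> 'm tvec \<Rightarrow> 'm tvec \<Rightarrow> real) \<Rightarrow> ('m vfield \<Rightarrow> 'm vfield \<Rightarrow> 'm vfield) \<Rightarrow>
     (nat \<Rightarrow> real) \<Rightarrow> 'm vfield \<Rightarrow> 'm vfield \<Rightarrow> 'm vfield \<Rightarrow> 'm \<Rightarrow> real" where
  "Q_tensor \<phi> \<xi> \<eta> g nabla t x y z p =
    (let F = (\<lambda>x y z. fundamental_tensor \<phi> g nabla x y z p);
         f = vf_map \<phi>;
         e = (\<lambda>x. \<eta> p (x p));
         \<omega> = (\<lambda>x. F \<xi> \<xi> x)
     in
       1/2 * (F x (f y) z + F x (f y) \<xi> * e z) - F x (f z) \<xi> * e y
     + t 1 * (F y x z + F (f y) (f x) z - F y x \<xi> * e z - F (f y) (f x) \<xi> * e z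
              - F y z \<xi> * e x - F \<xi> x z * e y + e x * e y * \<omega> z)
     + t 2 * (F z x y + F (f z) (f x) y - F z x \<xi> * e y - F (f z) (f x) \<xi> * e y
              - F z y \<xi> * e x - F \<xi> x y * e z + e x * e z * \<omega> y)
     + t 3 * (F y (f x) z - F (f y) x z - F y (f x) \<xi> * e z + F (f y) x \<xi> * e z
              - F y (f z) \<xi> * e x - F \<xi> (f x) z * e y + e x * e y * \<omega> (f z))
     + t 4 * (F z (f x) y - F (f z) x y - F z (f x) \<xi> * e y + F (f z) x \<xi> * e y
              - F z (f y) \<xi> * e x - F \<xi> (f x) y * e z + e x * e z * \<omega> (f y))
     + t 5 * (F (f y) z \<xi> + F y (f z) \<xi> - e y * \<omega> (f z)) * e x
     + t 6 * (F (f z) y \<xi> + F z (f y) \<xi> - \<omega> (f y) * e z) * e x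
     + t 7 * (F (f y) (f z) \<xi> - F y z \<xi> + e y * \<omega> z) * e x
     + t 8 * (F (f z) (f y) \<xi> - F z y \<xi> + \<omega> y * e z) * e x
     + t 9 * \<omega> x * e y * e z + t 10 * \<omega> (f x) * e y * e z)"

end

(* Since g(phi x, y) = g(x, phi y), the lowered tensor g((nabla'_x phi) y, z) equals
   F(x,y,z) + Q(x, phi y, z) - Q(x, y, phi z). This vanishes by a computation in which every term
   is reduced with the symmetries F(x,y,z) = F(x,z,y) and
   F(x, phi y, phi z) = F(x,y,z) - eta(y) F(x,xi,z) - eta(z) F(x,y,xi).
   The hypothesis on Q is only available for z the value of a global vector field; nondegeneracy
   of g applies because bump functions extend every tangent vector to such a field. *)
theory Submission
  imports Defs
begin

section \<open>Smooth maps and bump functions\<close>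

text \<open>The obstacle is that \<open>F\<close> and both connections take whole vector fields,
  whereas nondegeneracy of \<open>g\<close> concerns single tangent vectors. The algebra is
  therefore carried out with global fields read off at a fixed point, and only the last slot is
  passed from a vector to a field. That passage, and the closure of tangent spaces under linear
  combinations, which is not visible from velocities of curves, are the reason for the calculus of
  \<open>Ck_on\<close> and the work in charts. The shape of Q explains the cancellation. Its part
  without parameters satisfies Q(x, phi y, z) - Q(x, y, phi z) = -F(x, y, z), which offsets F. Every
  block B with a factor t_i satisfies B(x, phi y, z) = B(x, y, phi z): it is the lowered form of an
  endomorphism commuting with phi, so its coefficient is free.\<close>

lemma Ck_on_cong:
  assumes "open S" "\<And>x. x \<in> S \<Longrightarrow> f x = g x" "Ck_on k f S"
  shows "Ck_on k g S"
  using assms(2,3)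
proof (induction k arbitrary: f g)
  case 0
  then show ?case
    by (simp cong: continuous_on_cong)
next
  case (Suc k)
  have ev: "\<forall>\<^sub>F y in nhds x. f y = g y" if "x \<in> S" for x
    using assms(1) that Suc.prems(1) eventually_nhds by blast
  have d: "(g has_derivative frechet_derivative f (at x)) (at x)" if "x \<in> S" for x
    using Suc.prems that frechet_derivative_works
      has_derivative_transform_within_open[OF _ assms(1) that]
    by (metis Ck_on.simps(2))
  then have fd: "frechet_derivative g (at x) = frechet_derivative f (at x)" if "x \<in> S" for x
    using that frechet_derivative_at by metis
  show ?case
    unfolding Ck_on.simps
  proof (intro conjI ballI allI)
    show "g differentiable at x" if "x \<in> S" for x
      using d that differentiable_def by blast
    show "Ck_on k (\<lambda>x. frechet_derivative g (at x) h) S" for h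
      by (rule Suc.IH[of "\<lambda>x. frechet_derivative f (at x) h"]) (use Suc.prems fd in auto)
  qed
qed

text \<open>Derivatives at a point are unique and \<open>S\<close> is open, so
  \<open>Ck_on_cong\<close> exchanges the choice-based \<open>frechet_derivative\<close> for any
  derivative given in closed form.\<close>

lemma Ck_on_SucI:
  assumes "open S" "\<And>x. x \<in> S \<Longrightarrow> (f has_derivative f' x) (at x)"
    and "\<And>h. Ck_on k (\<lambda>x. f' x h) S"
  shows "Ck_on (Suc k) f S"
proof -
  have "frechet_derivative f (at x) = f' x" if "x \<in> S" for x
    using assms(2)[OF that] frechet_derivative_at by metis
  then have "Ck_on k (\<lambda>x. frechet_derivative f (at x) h) S" for h
    using Ck_on_cong[OF assms(1) _ assms(3), of h "\<lambda>x. frechet_derivative f (at x) h"] by auto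
  then show ?thesis
    using assms(2) by (auto simp: differentiable_def)
qed

lemma Ck_on_SucD:
  assumes "Ck_on (Suc k) f S"
  shows "Ck_on k f S"
  using assms
proof (induction k arbitrary: f)
  case 0
  then show ?case
    by (auto intro!: continuous_at_imp_continuous_on differentiable_imp_continuous_within)
next
  case (Suc k)
  then show ?case
    by (metis Ck_on.simps(2))
qed

lemma Ck_on_subset:
  assumes "Ck_on k f S" "T \<subseteq> S"
  shows "Ck_on k f T"
  using assms by (induction k arbitrary: f) (auto intro: continuous_on_subset)

text \<open>Continuity and differentiability are decided near each point. This glues a field that is
  given by different formulas on different open sets.\<close>

lemma Ck_on_local:
  assumes "\<And>x. x \<in> S \<Longrightarrow> \<exists>T. open T \<and> x \<in> T \<and> Ck_on k f T"
  shows "Ck_on k f S"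
  using assms
proof (induction k arbitrary: f)
  case 0
  then show ?case
    by (auto intro!: continuous_at_imp_continuous_on) (metis continuous_on_eq_continuous_at)
next
  case (Suc k)
  show ?case
    unfolding Ck_on.simps
  proof (intro conjI ballI allI)
    show "f differentiable at x" if "x \<in> S" for x
      using Suc.prems[OF that] by auto
    show "Ck_on k (\<lambda>x. frechet_derivative f (at x) h) S" for h
      by (rule Suc.IH) (use Suc.prems in \<open>metis Ck_on.simps(2)\<close>)
  qed
qed

lemma Ck_on_const: "Ck_on k (\<lambda>x. c) S"
proof (induction k arbitrary: c)
  case (Suc k)
  then show ?case by (simp add: frechet_derivative_const)
qed simp

lemma Ck_on_bounded_linear:
  assumes "bounded_linear L" "open S" "Ck_on k f S"
  shows "Ck_on k (\<lambda>x. L (f x)) S"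
  using assms(3)
proof (induction k arbitrary: f)
  case 0
  then show ?case
    using bounded_linear.continuous_on[OF assms(1)] by simp
next
  case (Suc k)
  have "(f has_derivative frechet_derivative f (at x)) (at x)" if "x \<in> S" for x
    using Suc.prems that by (simp flip: frechet_derivative_works)
  then show ?case
    using Suc
    by (intro Ck_on_SucI[OF assms(2), where f' = "\<lambda>x h. L (frechet_derivative f (at x) h)"]
        bounded_linear.has_derivative[OF assms(1)]) auto
qed

lemma Ck_on_id:
  assumes "open S"
  shows "Ck_on k (\<lambda>x. x) S"
  by (cases k) (auto intro!: Ck_on_SucI[OF assms, where f' = "\<lambda>x h. h"] Ck_on_const
      continuous_on_id has_derivative_ident)

lemma Ck_on_add:
  assumes "open S" "Ck_on k f S" "Ck_on k g S"
  shows "Ck_on k (\<lambda>x. f x + g x) S"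
  using assms(2,3)
proof (induction k arbitrary: f g)
  case 0
  then show ?case by (simp add: continuous_on_add)
next
  case (Suc k)
  have "(f has_derivative frechet_derivative f (at x)) (at x)"
    "(g has_derivative frechet_derivative g (at x)) (at x)" if "x \<in> S" for x
    using Suc.prems that by (simp_all flip: frechet_derivative_works)
  then show ?case
    using Suc
    by (intro Ck_on_SucI[OF assms(1), where f' =
          "\<lambda>x h. frechet_derivative f (at x) h + frechet_derivative g (at x) h"]
        has_derivative_add) auto
qed

lemma Ck_on_sum:
  assumes "open S" "\<And>i. i \<in> I \<Longrightarrow> Ck_on k (f i) S"
  shows "Ck_on k (\<lambda>x. \<Sum>i\<in>I. f i x) S"
  using assms(2)
  by (induction I rule: infinite_finite_induct) (auto intro: Ck_on_const Ck_on_add[OF assms(1)])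

lemma Ck_on_bilinear:
  assumes "bounded_bilinear m" "open S" "Ck_on k f S" "Ck_on k g S"
  shows "Ck_on k (\<lambda>x. m (f x) (g x)) S"
  using assms(3,4)
proof (induction k arbitrary: f g)
  case 0
  then show ?case using bounded_bilinear.continuous_on[OF assms(1)] by simp
next
  case (Suc k)
  have "(f has_derivative frechet_derivative f (at x)) (at x)"
    "(g has_derivative frechet_derivative g (at x)) (at x)" if "x \<in> S" for x
    using Suc.prems that by (simp_all flip: frechet_derivative_works)
  then have "((\<lambda>x. m (f x) (g x)) has_derivative (\<lambda>h. m (f x) (frechet_derivative g (at x) h) +
     m (frechet_derivative f (at x) h) (g x))) (at x)" if "x \<in> S" for x
    using that bounded_bilinear.FDERIV[OF assms(1)] by blast
  \<comment> \<open>The product rule leaves \<open>f\<close> and \<open>g\<close> undifferentiated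
    in one factor each, so they must themselves be of class \<open>k\<close> for the induction
    hypothesis.\<close>
  moreover have "Ck_on k f S" "Ck_on k g S"
    using Suc.prems Ck_on_SucD by blast+
  ultimately show ?case
    using Suc
    by (intro Ck_on_SucI[OF assms(2), where f' =
          "\<lambda>x h. m (f x) (frechet_derivative g (at x) h) + m (frechet_derivative f (at x) h) (g x)"]
        Ck_on_add[OF assms(2)]) auto
qed

text \<open>The chain rule yields \<open>g' (f x) (f' x h)\<close>, whose direction moves with
  \<open>x\<close>, while \<open>Ck_on\<close> only controls derivatives of \<open>g\<close> in
  fixed directions. Expanding \<open>f' x h\<close> in the basis leaves fixed directions
  \<open>i\<close> with real coefficients, to which the rules for sums and products and the
  induction hypothesis apply.\<close>

lemma Ck_on_compose:
  fixes f :: "'a::euclidean_space \<Rightarrow> 'b::euclidean_space" and g :: "'b \<Rightarrow> 'c::real_normed_vector"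
  assumes "open S" "open T" "\<And>x. x \<in> S \<Longrightarrow> f x \<in> T" "Ck_on k f S" "Ck_on k g T"
  shows "Ck_on k (\<lambda>x. g (f x)) S"
  using assms(4,5)
proof (induction k arbitrary: g)
  case 0
  then show ?case
    using assms(3) continuous_on_compose2[of T g S f] by auto
next
  case (Suc k)
  define f' where "f' x = frechet_derivative f (at x)" for x
  define g' where "g' x = frechet_derivative g (at x)" for x
  have f: "(f has_derivative f' x) (at x)" if "x \<in> S" for x
    using Suc.prems that by (simp add: f'_def flip: frechet_derivative_works)
  have g: "(g has_derivative g' x) (at x)" if "x \<in> T" for x
    using Suc.prems that by (simp add: g'_def flip: frechet_derivative_works)
  have lin: "linear (g' (f x))" if "x \<in> S" for x
    using assms(3)[OF that] g has_derivative_linear by blast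
  show ?case
  proof (rule Ck_on_SucI[OF assms(1)])
    show "((\<lambda>x. g (f x)) has_derivative (\<lambda>h. \<Sum>i\<in>Basis. (f' x h \<bullet> i) *\<^sub>R g' (f x) i)) (at x)"
      if "x \<in> S" for x
    proof -
      have "((\<lambda>x. g (f x)) has_derivative (\<lambda>h. g' (f x) (f' x h))) (at x)"
        using has_derivative_compose[OF f[OF that] g[OF assms(3)[OF that]]] .
      also have "(\<lambda>h. g' (f x) (f' x h)) = (\<lambda>h. \<Sum>i\<in>Basis. (f' x h \<bullet> i) *\<^sub>R g' (f x) i)"
      proof
        fix h
        have "g' (f x) (f' x h) = g' (f x) (\<Sum>i\<in>Basis. (f' x h \<bullet> i) *\<^sub>R i)"
          by (simp add: euclidean_representation)
        then show "g' (f x) (f' x h) = (\<Sum>i\<in>Basis. (f' x h \<bullet> i) *\<^sub>R g' (f x) i)"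
          using lin[OF that] by (simp add: linear_sum linear_scale)
      qed
      finally show ?thesis .
    qed
    show "Ck_on k (\<lambda>x. \<Sum>i\<in>Basis. (f' x h \<bullet> i) *\<^sub>R g' (f x) i) S" for h
    proof (intro Ck_on_sum[OF assms(1)] Ck_on_bilinear[OF bounded_bilinear_scaleR assms(1)])
      show "Ck_on k (\<lambda>x. f' x h \<bullet> i) S" for i
        using Suc.prems
        by (intro Ck_on_bounded_linear[OF bounded_linear_inner_left assms(1)]) (simp add: f'_def)
      show "Ck_on k (\<lambda>x. g' (f x) i) S" for i
        using Suc.prems Ck_on_SucD by (intro Suc.IH) (auto simp: g'_def)
    qed
  qed
qed

text \<open>\<open>exp_inv 1\<close> is the classical function exp(-1/t), flat at 0. The polynomial
  in \<open>1 / t\<close> records what differentiation produces: p becomes X^2 (p - p'), with X^2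
  coming from the derivative of 1/t.\<close>

definition exp_inv :: "real poly \<Rightarrow> real \<Rightarrow> real" where
  "exp_inv p t = (if t > 0 then poly p (1 / t) * exp (- 1 / t) else 0)"

text \<open>From the right, s = 1/t turns the claim into p(s) exp(-s) tending to 0 at infinity,
  where exp beats every monomial. From the left the function is 0.\<close>

lemma exp_inv_tendsto: "(exp_inv p \<longlongrightarrow> 0) (at 0)"
proof (rule filterlim_split_at)
  have "((\<lambda>x. \<Sum>i\<le>degree p. coeff p i * (x ^ i / exp x)) \<longlongrightarrow>
      (\<Sum>i\<le>degree p. coeff p i * 0)) at_top"
    by (intro tendsto_intros tendsto_power_div_exp_0)
  then have "((\<lambda>x. poly p x * exp (- x)) \<longlongrightarrow> 0) at_top"
    by (simp add: poly_altdef exp_minus sum_distrib_right divide_inverse mult.assoc)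
  then have "((\<lambda>t. poly p (inverse t) * exp (- inverse t)) \<longlongrightarrow> 0) (at_right 0)"
    using filterlim_compose filterlim_inverse_at_top_right by blast
  then show "(exp_inv p \<longlongrightarrow> 0) (at_right 0)"
    by (rule Lim_transform_eventually)
      (auto simp: exp_inv_def inverse_eq_divide eventually_at_filter)
  show "(exp_inv p \<longlongrightarrow> 0) (at_left 0)"
    by (rule tendsto_eventually) (auto simp: exp_inv_def eventually_at_filter)
qed

text \<open>The functions \<open>exp_inv p\<close> are smooth at \<open>0\<close> because differentiation only changes \<open>p\<close>.\<close>

lemma exp_inv_has_derivative:
  "(exp_inv p has_real_derivative exp_inv ([:0, 0, 1:] * (p - pderiv p)) t) (at t)"
proof (cases "t = 0")
  case True
  \<comment> \<open>The difference quotient at 0 belongs to the same family, with polynomial X p, so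
    its limit is already known.\<close>
  have "((\<lambda>h. exp_inv ([:0, 1:] * p) h) \<longlongrightarrow> 0) (at 0)"
    by (rule exp_inv_tendsto)
  moreover have "exp_inv ([:0, 1:] * p) h = exp_inv p h / h" for h
    by (simp add: exp_inv_def)
  ultimately show ?thesis
    using True by (simp add: DERIV_def exp_inv_def)
next
  case False
  show ?thesis
  proof (cases "t > 0")
    case True
    have "((\<lambda>t. poly p (1 / t) * exp (- 1 / t)) has_real_derivative
        exp_inv ([:0, 0, 1:] * (p - pderiv p)) t) (at t)"
      using True
      by (auto intro!: derivative_eq_intros DERIV_chain2[OF poly_DERIV] simp: exp_inv_def field_simps power2_eq_square)
    then show ?thesis
      by (rule has_field_derivative_transform_within_open[of _ _ _ "{0<..}"])
        (use True in \<open>auto simp: exp_inv_def\<close>)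
  next
    case False
    have "((\<lambda>t. 0) has_real_derivative exp_inv ([:0, 0, 1:] * (p - pderiv p)) t) (at t)"
      using False by (simp add: exp_inv_def)
    then show ?thesis
      by (rule has_field_derivative_transform_within_open[of _ _ _ "{..<0}"])
        (use False \<open>t \<noteq> 0\<close> in \<open>auto simp: exp_inv_def\<close>)
  qed
qed

lemma Ck_on_exp_inv: "Ck_on k (exp_inv p) UNIV"
proof (induction k arbitrary: p)
  case 0
  then show ?case
    using exp_inv_has_derivative DERIV_continuous_on by (metis Ck_on.simps(1))
next
  case (Suc k)
  show ?case
  proof (rule Ck_on_SucI[where f' = "\<lambda>t h. exp_inv ([:0, 0, 1:] * (p - pderiv p)) t * h"])
    show "(exp_inv p has_derivative (\<lambda>h. exp_inv ([:0, 0, 1:] * (p - pderiv p)) x * h)) (at x)" for x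
      using exp_inv_has_derivative by (simp add: has_field_derivative_def)
    show "Ck_on k (\<lambda>x. exp_inv ([:0, 0, 1:] * (p - pderiv p)) x * h) UNIV" for h
      by (intro Ck_on_bounded_linear[OF bounded_linear_mult_left] Suc.IH) simp
  qed simp
qed

text \<open>The squared distance is smooth also at the centre, and dividing by the value there
  normalises \<open>b c\<close> to 1. The support is confined to a closed ball because compactness
  of that ball is what the extension of tangent vectors uses.\<close>

lemma bump_exists:
  fixes c :: "'a::euclidean_space"
  assumes "r > 0"
  obtains b :: "'a \<Rightarrow> real" where "\<And>k. Ck_on k b UNIV" "b c = 1" "\<And>x. x \<notin> cball c r \<Longrightarrow> b x = 0"
proof
  define e where "e = exp_inv 1"
  let ?b = "\<lambda>x. e (r\<^sup>2 - (x - c) \<bullet> (x - c)) / e (r\<^sup>2)"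
  have id: "Ck_on k (\<lambda>x. x - c) UNIV" for k
    using Ck_on_add[OF open_UNIV Ck_on_id[OF open_UNIV] Ck_on_const[of _ "-c"]] by simp
  have "Ck_on k (\<lambda>x. (x - c) \<bullet> (x - c)) UNIV" for k
    by (rule Ck_on_bilinear[OF bounded_bilinear_inner _ id id]) simp
  then have "Ck_on k (\<lambda>x. r\<^sup>2 + (- ((x - c) \<bullet> (x - c)))) UNIV" for k
    by (intro Ck_on_add Ck_on_const Ck_on_bounded_linear[OF bounded_linear_minus] bounded_linear_ident) auto
  then have "Ck_on k (\<lambda>x. e (r\<^sup>2 + (- ((x - c) \<bullet> (x - c))))) UNIV" for k
    unfolding e_def by (intro Ck_on_compose[OF _ open_UNIV _ _ Ck_on_exp_inv]) auto
  then show "Ck_on k ?b UNIV" for k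
    by (intro Ck_on_bounded_linear[OF bounded_linear_divide]) auto
  show "?b c = 1"
    using assms by (simp add: e_def exp_inv_def)
  show "?b x = 0" if "x \<notin> cball c r" for x
  proof -
    have "r < norm (x - c)"
      using that by (simp add: dist_norm norm_minus_commute)
    then have "r\<^sup>2 < (norm (x - c))\<^sup>2"
      using assms by (intro power_strict_mono) auto
    then show ?thesis
      by (simp add: e_def exp_inv_def power2_norm_eq_inner)
  qed
qed

section \<open>Tangent spaces in charts\<close>

locale smooth_manifold =
  fixes A :: "('m::{t2_space,second_countable_topology}, 'e::euclidean_space) atlas"
  assumes smooth_atlas: "smooth_atlas A"
begin

lemma chart_homeomorphism:
  assumes "(U, \<kappa>) \<in> A"
  shows "open U" "open (\<kappa> ` U)" "homeomorphism U (\<kappa> ` U) \<kappa> (inv_into U \<kappa>)"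
  using smooth_atlas assms unfolding smooth_atlas_def by auto

lemma chart_inv [simp]:
  assumes "(U, \<kappa>) \<in> A" "p \<in> U"
  shows "inv_into U \<kappa> (\<kappa> p) = p"
  using chart_homeomorphism(3)[OF assms(1)] assms(2) homeomorphism_apply1 by blast

lemma chart_exists: obtains U \<kappa> where "(U, \<kappa>) \<in> A" "p \<in> U"
  using smooth_atlas unfolding smooth_atlas_def by blast

lemma open_chart_preimage:
  assumes "(U, \<kappa>) \<in> A" "open V"
  shows "open (\<kappa> ` (U \<inter> V))"
proof -
  have "\<kappa> ` (U \<inter> V) = \<kappa> ` U \<inter> inv_into U \<kappa> -` V"
    using assms(1) by auto
  then show ?thesis
    using chart_homeomorphism[OF assms(1)] assms(2)
    by (simp add: homeomorphism_cont2 continuous_open_preimage)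
qed

lemma Ck_on_transition:
  assumes "(U, \<kappa>) \<in> A" "(V, \<kappa>') \<in> A"
  shows "Ck_on k (\<lambda>x. \<kappa>' (inv_into U \<kappa> x)) (\<kappa> ` (U \<inter> V))"
  using smooth_atlas assms unfolding smooth_atlas_def smooth_on_def o_def by blast

section \<open>Smooth functions and tangent vectors in coordinates\<close>

lemma smooth_fun_iff:
  "smooth_fun A f \<longleftrightarrow> (\<forall>U \<kappa> k. (U, \<kappa>) \<in> A \<longrightarrow> Ck_on k (\<lambda>x. f (inv_into U \<kappa> x)) (\<kappa> ` U))"
  unfolding smooth_fun_def smooth_on_def o_def by auto

lemma smooth_fun_const: "smooth_fun A (\<lambda>p. c)"
  by (simp add: smooth_fun_iff Ck_on_const)

lemma smooth_fun_add:
  "smooth_fun A u \<Longrightarrow> smooth_fun A v \<Longrightarrow> smooth_fun A (\<lambda>p. u p + v p)"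
  unfolding smooth_fun_iff by (auto intro!: Ck_on_add chart_homeomorphism(2))

lemma smooth_fun_mult:
  "smooth_fun A u \<Longrightarrow> smooth_fun A v \<Longrightarrow> smooth_fun A (\<lambda>p. u p * v p)"
  unfolding smooth_fun_iff
  by (auto intro!: Ck_on_bilinear[OF bounded_bilinear_mult] chart_homeomorphism(2))

text \<open>The tangent vector with coordinates \<open>w\<close> in the chart. The default 0 on
  non-smooth functions matches \<open>velocity\<close>, so that equations between the two hold as
  equations of functionals.\<close>

definition coord_vec :: "'m set \<Rightarrow> ('m \<Rightarrow> 'e) \<Rightarrow> 'm \<Rightarrow> 'e \<Rightarrow> 'm tvec" where
  "coord_vec U \<kappa> p w = (\<lambda>f. if smooth_fun A f
     then frechet_derivative (\<lambda>x. f (inv_into U \<kappa> x)) (at (\<kappa> p)) w else 0)"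

lemma smooth_fun_has_derivative:
  assumes "smooth_fun A f" "(U, \<kappa>) \<in> A" "p \<in> U"
  defines "f' \<equiv> \<lambda>x. f (inv_into U \<kappa> x)"
  shows "(f' has_derivative frechet_derivative f' (at (\<kappa> p))) (at (\<kappa> p))"
proof -
  have "Ck_on (Suc 0) f' (\<kappa> ` U)"
    using assms smooth_fun_iff by blast
  then show ?thesis
    using assms(3) frechet_derivative_works by auto
qed

lemma linear_coord_vec:
  assumes "(U, \<kappa>) \<in> A" "p \<in> U"
  shows "coord_vec U \<kappa> p (a *\<^sub>R v + b *\<^sub>R w) =
    tv_add (tv_scale a (coord_vec U \<kappa> p v)) (tv_scale b (coord_vec U \<kappa> p w))"
  using has_derivative_linear[OF smooth_fun_has_derivative[OF _ assms]]
  by (fastforce simp: coord_vec_def tv_add_def tv_scale_def linear_add linear_scale)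

text \<open>Near 0 the function \<open>f \<circ> \<gamma>\<close> factors through the chart, and the
  chain rule shows that only the coordinate velocity of the curve matters.\<close>

lemma velocity_eq_coord_vec:
  assumes "(U, \<kappa>) \<in> A" "\<gamma> 0 \<in> U" "\<epsilon> > 0" "smooth_curve A \<epsilon> \<gamma>"
  shows "velocity A \<gamma> = coord_vec U \<kappa> (\<gamma> 0) (frechet_derivative (\<lambda>t. \<kappa> (\<gamma> t)) (at 0) 1)"
proof -
  define S where "S = {t\<in>{-\<epsilon><..<\<epsilon>}. \<gamma> t \<in> U}"
  have "S = {-\<epsilon><..<\<epsilon>} \<inter> \<gamma> -` U"
    by (auto simp: S_def)
  then have S: "open S" "0 \<in> S"
    using assms chart_homeomorphism(1)[OF assms(1)] continuous_open_preimage[of "{-\<epsilon><..<\<epsilon>}" \<gamma> U]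
    by (auto simp: smooth_curve_def)
  have "Ck_on (Suc 0) (\<lambda>t. \<kappa> (\<gamma> t)) S"
    using assms unfolding smooth_curve_def smooth_on_def S_def o_def by blast
  then have D: "((\<lambda>t. \<kappa> (\<gamma> t)) has_derivative frechet_derivative (\<lambda>t. \<kappa> (\<gamma> t)) (at 0)) (at 0)"
    using S frechet_derivative_works by auto
  let ?c = "frechet_derivative (\<lambda>t. \<kappa> (\<gamma> t)) (at 0)"
  show "velocity A \<gamma> = coord_vec U \<kappa> (\<gamma> 0) (?c 1)"
  proof
    fix f
    show "velocity A \<gamma> f = coord_vec U \<kappa> (\<gamma> 0) (?c 1) f"
    proof (cases "smooth_fun A f")
      case True
      define F where "F = frechet_derivative (\<lambda>x. f (inv_into U \<kappa> x)) (at (\<kappa> (\<gamma> 0)))"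
      have "((\<lambda>t. f (inv_into U \<kappa> (\<kappa> (\<gamma> t)))) has_derivative (\<lambda>h. F (?c h))) (at 0)"
        using has_derivative_compose[OF D smooth_fun_has_derivative[OF True assms(1,2)]]
        unfolding F_def .
      then have fd: "((\<lambda>t. f (\<gamma> t)) has_derivative (\<lambda>h. F (?c h))) (at 0)"
        by (rule has_derivative_transform_within_open[OF _ S]) (use assms(1) in \<open>auto simp: S_def\<close>)
      have "(\<lambda>h. F (?c h)) = (*) (F (?c 1))"
      proof
        show "F (?c h) = F (?c 1) * h" for h
          using linear_scale[OF has_derivative_linear[OF fd], of h 1] by simp
      qed
      then have "(f \<circ> \<gamma> has_real_derivative F (?c 1)) (at 0)"
        using fd unfolding has_field_derivative_def o_def by simp
      then show ?thesis
        using True by (simp add: velocity_def coord_vec_def F_def DERIV_imp_deriv)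
    qed (simp add: velocity_def coord_vec_def)
  qed
qed

text \<open>The curve is the straight line through \<open>\<kappa> p\<close> in direction
  \<open>w\<close>, pulled back by the chart for times at which it stays in the chart image. In
  another chart \<open>V\<close> it is a transition map along that line, hence smooth.\<close>

lemma coord_vec_in_tangent_space:
  assumes "(U, \<kappa>) \<in> A" "p \<in> U"
  shows "coord_vec U \<kappa> p w \<in> tangent_space A p"
proof -
  define l where "l = (\<lambda>t. \<kappa> p + t *\<^sub>R w)"
  define \<gamma> where "\<gamma> = (\<lambda>t. inv_into U \<kappa> (l t))"
  have cont: "continuous_on X l" for X
    unfolding l_def by (intro continuous_intros)
  have D: "(l has_derivative (\<lambda>h. h *\<^sub>R w)) (at t)" for t
    unfolding l_def by (auto intro!: derivative_eq_intros)
  have Ck: "Ck_on k l X" if "open X" for k X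
    unfolding l_def
    by (intro Ck_on_add Ck_on_const Ck_on_bounded_linear[OF bounded_linear_scaleR_left] Ck_on_id that)
  have "open (l -` (\<kappa> ` U))"
    using chart_homeomorphism(2)[OF assms(1)] cont by (simp add: open_vimage)
  moreover have "0 \<in> l -` (\<kappa> ` U)"
    using assms by (simp add: l_def)
  ultimately obtain \<epsilon> where \<epsilon>: "\<epsilon> > 0" "ball 0 \<epsilon> \<subseteq> l -` (\<kappa> ` U)"
    using openE by blast
  then have sub: "l t \<in> \<kappa> ` U" if "t \<in> {-\<epsilon><..<\<epsilon>}" for t
    using that by (auto simp: subset_iff dist_norm)
  have cg: "continuous_on {-\<epsilon><..<\<epsilon>} \<gamma>"
    unfolding \<gamma>_def using sub
    by (intro continuous_on_compose2[OF
          homeomorphism_cont2[OF chart_homeomorphism(3)[OF assms(1)]] cont]) auto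
  have "smooth_curve A \<epsilon> \<gamma>"
    unfolding smooth_curve_def smooth_on_def
  proof (safe intro!: cg)
    fix V \<kappa>' k assume V: "(V, \<kappa>') \<in> A"
    let ?S = "{t\<in>{-\<epsilon><..<\<epsilon>}. \<gamma> t \<in> V}"
    have "open ({-\<epsilon><..<\<epsilon>} \<inter> \<gamma> -` V)"
      using continuous_open_preimage[OF cg _ chart_homeomorphism(1)[OF V]] by simp
    moreover have "{-\<epsilon><..<\<epsilon>} \<inter> \<gamma> -` V = ?S"
      by auto
    ultimately have S: "open ?S"
      by simp
    have "l t \<in> \<kappa> ` (U \<inter> V)" if "t \<in> ?S" for t
    proof -
      have "l t = \<kappa> (\<gamma> t)" "\<gamma> t \<in> U"
        using that sub[of t] by (auto simp: \<gamma>_def f_inv_into_f inv_into_into)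
      then show ?thesis
        using that by auto
    qed
    then show "Ck_on k (\<kappa>' \<circ> \<gamma>) ?S"
      unfolding o_def \<gamma>_def[abs_def]
      using S by (intro Ck_on_compose[OF _ open_chart_preimage[OF assms(1) chart_homeomorphism(1)[OF V]]
            _ Ck Ck_on_transition[OF assms(1) V]]) (auto simp: \<gamma>_def)
  qed
  moreover have g0: "\<gamma> 0 = p"
    using assms by (simp add: \<gamma>_def l_def)
  moreover have "velocity A \<gamma> = coord_vec U \<kappa> p w"
  proof -
    have "((\<lambda>t. \<kappa> (\<gamma> t)) has_derivative (\<lambda>h. h *\<^sub>R w)) (at 0)"
      by (rule has_derivative_transform_within_open[OF D, of "{-\<epsilon><..<\<epsilon>}"])
        (use \<epsilon> sub in \<open>auto simp: \<gamma>_def f_inv_into_f\<close>)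
    then have "frechet_derivative (\<lambda>t. \<kappa> (\<gamma> t)) (at 0) 1 = w"
      using frechet_derivative_at by (metis scaleR_one)
    then show ?thesis
      using velocity_eq_coord_vec[OF assms(1) _ \<epsilon>(1) calculation(1)] g0 assms(2) by simp
  qed
  ultimately show ?thesis
    using \<epsilon>(1) unfolding tangent_space_def by (simp only: mem_Collect_eq) metis
qed

text \<open>This gives access to the linear structure: a sum of velocities is not evidently a
  velocity, but coordinates can be added.\<close>

lemma tangent_space_eq:
  assumes "(U, \<kappa>) \<in> A" "p \<in> U"
  shows "tangent_space A p = range (coord_vec U \<kappa> p)"
proof
  show "tangent_space A p \<subseteq> range (coord_vec U \<kappa> p)"
    using velocity_eq_coord_vec[OF assms(1)] assms(2) unfolding tangent_space_def by blast
qed (use coord_vec_in_tangent_space[OF assms] in auto)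

lemma tangent_space_lincomb:
  assumes "v \<in> tangent_space A p" "w \<in> tangent_space A p"
  shows "tv_add (tv_scale a v) (tv_scale b w) \<in> tangent_space A p"
proof -
  obtain U \<kappa> where U: "(U, \<kappa>) \<in> A" "p \<in> U"
    using chart_exists .
  then obtain v' w' where "v = coord_vec U \<kappa> p v'" "w = coord_vec U \<kappa> p w'"
    using assms tangent_space_eq by blast
  then show ?thesis
    using linear_coord_vec[OF U] coord_vec_in_tangent_space[OF U] by metis
qed

lemma tangent_space_add:
  assumes "v \<in> tangent_space A p" "w \<in> tangent_space A p"
  shows "tv_add v w \<in> tangent_space A p"
  using tangent_space_lincomb[OF assms, of 1 1] by (simp add: tv_scale_def)

lemma tangent_space_scale:
  assumes "v \<in> tangent_space A p"
  shows "tv_scale c v \<in> tangent_space A p"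
  using tangent_space_lincomb[OF assms assms, of c 0] by (simp add: tv_scale_def tv_add_def)

lemma coord_vec_0:
  assumes "(U, \<kappa>) \<in> A" "p \<in> U"
  shows "coord_vec U \<kappa> p 0 = tv_zero"
  using linear_coord_vec[OF assms, of 0 0 0 0]
  by (simp add: tv_zero_def tv_add_def tv_scale_def)

section \<open>Vector fields as a module over the smooth functions, and extension of tangent
  vectors\<close>

lemma vector_field_add:
  assumes "vector_field A X" "vector_field A Y"
  shows "vector_field A (vf_add X Y)"
  using assms smooth_fun_add tangent_space_add
  by (auto simp: vector_field_def vf_add_def vf_apply_def tv_add_def[abs_def])

lemma vector_field_scale:
  assumes "smooth_fun A u" "vector_field A X"
  shows "vector_field A (vf_scale u X)"
  using assms smooth_fun_mult tangent_space_scale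
  by (auto simp: vector_field_def vf_scale_def vf_apply_def tv_scale_def[abs_def])

lemma vector_field_diff:
  assumes "vector_field A X" "vector_field A Y"
  shows "vector_field A (vf_diff X Y)"
  unfolding vf_diff_def using assms
  by (intro vector_field_add vector_field_scale smooth_fun_const)

text \<open>The field has constant coordinates \<open>w\<close> in the chart, damped by a bump
  function, and is 0 outside \<open>U\<close>. Smoothness is checked on two open sets: on
  \<open>U\<close> by the formula, off the support set \<open>K\<close> because the field vanishes
  there.\<close>

lemma tangent_vector_extension:
  assumes "v \<in> tangent_space A p"
  obtains X where "vector_field A X" "X p = v"
proof -
  obtain U \<kappa> where U: "(U, \<kappa>) \<in> A" "p \<in> U"
    using chart_exists .
  obtain w where w: "v = coord_vec U \<kappa> p w"
    using assms tangent_space_eq[OF U] by auto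
  obtain r where r: "r > 0" "cball (\<kappa> p) r \<subseteq> \<kappa> ` U"
    using chart_homeomorphism(2)[OF U(1)] U(2) open_contains_cball by blast
  obtain b where b: "\<And>k. Ck_on k b UNIV" "b (\<kappa> p) = (1::real)"
    "\<And>x. x \<notin> cball (\<kappa> p) r \<Longrightarrow> b x = 0"
    using bump_exists[OF r(1)] by blast
  define X where "X q = (if q \<in> U then coord_vec U \<kappa> q (b (\<kappa> q) *\<^sub>R w) else tv_zero)" for q
  define K where "K = inv_into U \<kappa> ` cball (\<kappa> p) r"
  have "continuous_on (cball (\<kappa> p) r) (inv_into U \<kappa>)"
    using chart_homeomorphism(3)[OF U(1)] r(2) homeomorphism_cont2 continuous_on_subset by blast
  \<comment> \<open>Compact sets are closed since the manifold is Hausdorff. As \<open>K\<close>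
    lies in \<open>U\<close>, the open sets \<open>U\<close> and \<open>- K\<close> cover the
    manifold.\<close>
  then have "closed K"
    unfolding K_def using compact_continuous_image compact_imp_closed compact_cball by blast
  have K: "X q = tv_zero" if "q \<notin> K" for q
  proof (cases "q \<in> U")
    case True
    then have "\<kappa> q \<notin> cball (\<kappa> p) r"
      using that U(1) unfolding K_def by (metis chart_inv imageI)
    then show ?thesis
      using True U(1) b(3) by (simp add: X_def coord_vec_0)
  qed (simp add: X_def)
  have "vector_field A X"
    unfolding vector_field_def
  proof (intro conjI allI impI)
    fix q
    obtain V \<kappa>' where "(V, \<kappa>') \<in> A" "q \<in> V"
      using chart_exists .
    then have "tv_zero \<in> tangent_space A q"
      using coord_vec_in_tangent_space coord_vec_0 by metis
    then show "X q \<in> tangent_space A q"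
      using U(1) coord_vec_in_tangent_space by (simp add: X_def)
  next
    fix f assume f: "smooth_fun A f"
    define f' where "f' x = frechet_derivative (\<lambda>x. f (inv_into U \<kappa> x)) (at x)" for x
    have f'U: "X q f = b (\<kappa> q) * f' (\<kappa> q) w" if "q \<in> U" for q
      using that linear_scale[OF has_derivative_linear[OF smooth_fun_has_derivative[OF f U(1) that]]] f
      by (simp add: X_def coord_vec_def f'_def)
    show "smooth_fun A (vf_apply X f)"
      unfolding smooth_fun_iff vf_apply_def
    proof (intro allI impI, rule Ck_on_local)
      fix V \<kappa>' k x assume V: "(V, \<kappa>') \<in> A" and x: "x \<in> \<kappa>' ` V"
      show "\<exists>T. open T \<and> x \<in> T \<and> Ck_on k (\<lambda>x. X (inv_into V \<kappa>' x) f) T"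
      proof (cases "inv_into V \<kappa>' x \<in> U")
        case True
        let ?T = "\<kappa>' ` (V \<inter> U)"
        have T: "open ?T" "x \<in> ?T"
          using open_chart_preimage[OF V] chart_homeomorphism(1)[OF U(1)] V x True by auto
        have "Ck_on (Suc k) (\<lambda>x. f (inv_into U \<kappa> x)) (\<kappa> ` U)"
          using f U(1) smooth_fun_iff by blast
        then have "Ck_on k (\<lambda>y. b y * f' y w) (\<kappa> ` U)"
          using Ck_on_subset[OF b(1)] chart_homeomorphism(2)[OF U(1)]
          by (intro Ck_on_bilinear[OF bounded_bilinear_mult]) (auto simp: f'_def)
        then have "Ck_on k (\<lambda>x. b (\<kappa> (inv_into V \<kappa>' x)) * f' (\<kappa> (inv_into V \<kappa>' x)) w) ?T"
          by (intro Ck_on_compose[OF T(1) chart_homeomorphism(2)[OF U(1)] _ Ck_on_transition[OF V U(1)]])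
            (use V in auto)
        then have "Ck_on k (\<lambda>x. X (inv_into V \<kappa>' x) f) ?T"
          by (rule Ck_on_cong[OF T(1), rotated]) (use V f'U in auto)
        then show ?thesis
          using T by blast
      next
        case False
        let ?T = "\<kappa>' ` (V \<inter> - K)"
        have "K \<subseteq> U"
          using r(2) by (auto simp: K_def intro: inv_into_into)
        then have T: "open ?T" "x \<in> ?T"
          using open_chart_preimage[OF V, of "- K"] \<open>closed K\<close> V x False by auto
        have "Ck_on k (\<lambda>x. X (inv_into V \<kappa>' x) f) ?T"
          by (rule Ck_on_cong[OF T(1) _ Ck_on_const[of _ 0]]) (use V K in \<open>auto simp: tv_zero_def\<close>)
        then show ?thesis
          using T by blast
      qed
    qed
  qed
  moreover have "X p = v"
    using U b(2) w by (simp add: X_def)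
  ultimately show ?thesis
    using that by blast
qed

end

section \<open>The fundamental tensor\<close>

text \<open>The computation is stripped of geometry: \<open>k\<close> stands for xi,
  \<open>e\<close> for eta, and \<open>'v\<close> carries no linear structure, since linear
  combinations arise only from applying phi twice and \<open>f1\<close> and \<open>f3\<close> supply
  them. The blocks of \<open>t 2\<close>, \<open>t 4\<close>, \<open>t 6\<close>, \<open>t 8\<close>
  are those of \<open>t 1\<close>, \<open>t 3\<close>, \<open>t 5\<close>, \<open>t 7\<close> with
  \<open>y\<close> and \<open>z\<close> exchanged; the last two terms vanish on both sides because
  \<open>e (f a) = 0\<close>.\<close>

lemma Q_phi_identity:
  fixes F :: "'v \<Rightarrow> 'v \<Rightarrow> 'v \<Rightarrow> real" and f :: "'v \<Rightarrow> 'v" and e :: "'v \<Rightarrow> real" and k :: 'v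
    and t :: "nat \<Rightarrow> real" and V :: "'v \<Rightarrow> bool"
  assumes V: "V k" "\<And>a. V a \<Longrightarrow> V (f a)"
    and e: "e k = 1" "\<And>a. V a \<Longrightarrow> e (f a) = 0"
    and sym: "\<And>a b c. V a \<Longrightarrow> V b \<Longrightarrow> V c \<Longrightarrow> F a b c = F a c b"
    and f1: "\<And>a b c. V a \<Longrightarrow> V b \<Longrightarrow> V c \<Longrightarrow> F (f (f a)) b c = - F a b c + e a * F k b c"
    and f3: "\<And>a b c. V a \<Longrightarrow> V b \<Longrightarrow> V c \<Longrightarrow> F a b (f (f c)) = - F a b c + e c * F a b k"
    and ff: "\<And>a b c. V a \<Longrightarrow> V b \<Longrightarrow> V c \<Longrightarrow> F a (f b) (f c) = F a b c - e b * F a k c - e c * F a b k"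
    and kk: "\<And>a. V a \<Longrightarrow> F a k k = 0"
  assumes v: "V x" "V y" "V z"
  defines "Q \<equiv> (\<lambda>x y z. 1/2 * (F x (f y) z + F x (f y) k * e z) - F x (f z) k * e y
     + t 1 * (F y x z + F (f y) (f x) z - F y x k * e z - F (f y) (f x) k * e z
              - F y z k * e x - F k x z * e y + e x * e y * F k k z)
     + t 2 * (F z x y + F (f z) (f x) y - F z x k * e y - F (f z) (f x) k * e y
              - F z y k * e x - F k x y * e z + e x * e z * F k k y)
     + t 3 * (F y (f x) z - F (f y) x z - F y (f x) k * e z + F (f y) x k * e z
              - F y (f z) k * e x - F k (f x) z * e y + e x * e y * F k k (f z))
     + t 4 * (F z (f x) y - F (f z) x y - F z (f x) k * e y + F (f z) x k * e y
              - F z (f y) k * e x - F k (f x) y * e z + e x * e z * F k k (f y))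
     + t 5 * (F (f y) z k + F y (f z) k - e y * F k k (f z)) * e x
     + t 6 * (F (f z) y k + F z (f y) k - F k k (f y) * e z) * e x
     + t 7 * (F (f y) (f z) k - F y z k + e y * F k k z) * e x
     + t 8 * (F (f z) (f y) k - F z y k + F k k y * e z) * e x
     + t 9 * F k k x * e y * e z + t 10 * F k k (f x) * e y * e z)"
  shows "F x y z + Q x (f y) z = Q x y (f z)"
proof -
  \<comment> \<open>The normal form keeps \<open>k\<close> in the last slot and has no double
    \<open>f\<close> in any slot.\<close>
  have ks: "F a k b = F a b k" if "V a" "V b" for a b using sym that V by blast
  have f2: "F a (f (f b)) c = - F a b c + e b * F a c k" if "V a" "V b" "V c" for a b c
    using f3[of a c b] that sym[of a "f (f b)" c] sym[of a b c] V by simp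
  have ff': "F a (f b) (f c) = F a b c - e b * F a c k - e c * F a b k" if "V a" "V b" "V c" for a b c
    using ff that ks by simp
  \<comment> \<open>Moving \<open>f\<close> out of the third argument makes the reduction confluent.\<close>
  have sw: "F a b (f c) = - F a (f b) c + e c * F a (f b) k + e b * F a (f c) k"
     if "V a" "V b" "V c" for a b c
    using ff'[of a b "f c"] that f3[of a "f b" c] V e by simp
  have ksx: "F a k (f b) = F a (f b) k" if "V a" "V b" for a b using ks that V by blast
  \<comment> \<open>Instantiating \<open>sw\<close> at \<open>x\<close>, \<open>y\<close>,
    \<open>z\<close> keeps it from competing with \<open>ff'\<close> on
    \<open>F a (f b) (f c)\<close>; instantiating \<open>ks\<close> keeps it from rewriting
    \<open>F a k k\<close> to itself.\<close>
  show ?thesis unfolding Q_def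
    by (simp add: V v e f1 f2 f3 ff' kk ks[OF _ v(1)] ks[OF _ v(2)] ks[OF _ v(3)] ksx
        sw[OF _ v(1) v(2)] sw[OF _ v(1) v(3)] sw[OF _ v(2) v(3)] algebra_simps)
qed

section \<open>Pointwise algebra of phi, xi, eta and g\<close>

locale norden_manifold = smooth_manifold A
  for A :: "('m::{t2_space,second_countable_topology}, 'e::euclidean_space) atlas" +
  fixes \<phi> :: "'m \<Rightarrow> 'm tvec \<Rightarrow> 'm tvec" and \<xi> :: "'m vfield"
    and \<eta> :: "'m \<Rightarrow> 'm tvec \<Rightarrow> real" and g :: "'m \<Rightarrow> 'm tvec \<Rightarrow> 'm tvec \<Rightarrow> real"
  assumes norden: "almost_contact_norden A \<phi> \<xi> \<eta> g"
begin

abbreviation T where "T \<equiv> tangent_space A"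
abbreviation V where "V \<equiv> vector_field A"
abbreviation f where "f \<equiv> vf_map \<phi>"

lemma V_tangent: "V X \<Longrightarrow> X p \<in> T p"
  by (simp add: vector_field_def)

lemma structure_vector_field:
  "V \<xi>" "V X \<Longrightarrow> V (f X)" "V X \<Longrightarrow> smooth_fun A (\<lambda>p. \<eta> p (X p))"
  using norden by (auto simp: almost_contact_norden_def tangent_endomorphism_def one_form_def)

lemma xi_tangent: "\<xi> p \<in> T p"
  by (intro V_tangent structure_vector_field)

lemma phi_tangent: "v \<in> T p \<Longrightarrow> \<phi> p v \<in> T p"
  using norden by (auto simp: almost_contact_norden_def tangent_endomorphism_def)

lemma phi_lincomb: "v \<in> T p \<Longrightarrow> w \<in> T p \<Longrightarrow>
    \<phi> p (tv_add (tv_scale a v) (tv_scale b w)) = tv_add (tv_scale a (\<phi> p v)) (tv_scale b (\<phi> p w))"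
  using norden by (auto simp: almost_contact_norden_def tangent_endomorphism_def)

lemma phi_phi: "v \<in> T p \<Longrightarrow>
    \<phi> p (\<phi> p v) = tv_add (tv_scale (- 1) v) (tv_scale (\<eta> p v) (\<xi> p))"
  using norden by (auto simp: almost_contact_norden_def)

lemma eta_xi: "\<eta> p (\<xi> p) = 1"
  using norden by (auto simp: almost_contact_norden_def)

lemma eta_lincomb: "v \<in> T p \<Longrightarrow> w \<in> T p \<Longrightarrow>
    \<eta> p (tv_add (tv_scale a v) (tv_scale b w)) = a * \<eta> p v + b * \<eta> p w"
  using norden by (auto simp: almost_contact_norden_def one_form_def)

lemma g_phi_phi: "v \<in> T p \<Longrightarrow> w \<in> T p \<Longrightarrow>
    g p (\<phi> p v) (\<phi> p w) = - g p v w + \<eta> p v * \<eta> p w"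
  using norden by (auto simp: almost_contact_norden_def)

lemma g_sym: "v \<in> T p \<Longrightarrow> w \<in> T p \<Longrightarrow> g p v w = g p w v"
  using norden by (auto simp: almost_contact_norden_def pseudo_riemannian_metric_def)

lemma g_lincomb_left: "u \<in> T p \<Longrightarrow> v \<in> T p \<Longrightarrow> w \<in> T p \<Longrightarrow>
    g p (tv_add (tv_scale a u) (tv_scale b v)) w = a * g p u w + b * g p v w"
  using norden by (auto simp: almost_contact_norden_def pseudo_riemannian_metric_def)

lemma g_lincomb_right: "u \<in> T p \<Longrightarrow> v \<in> T p \<Longrightarrow> w \<in> T p \<Longrightarrow>
    g p w (tv_add (tv_scale a u) (tv_scale b v)) = a * g p w u + b * g p w v"
  by (simp add: g_sym[of w] tangent_space_lincomb g_lincomb_left)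

lemma g_add_left: "u \<in> T p \<Longrightarrow> v \<in> T p \<Longrightarrow> w \<in> T p \<Longrightarrow> g p (tv_add u v) w = g p u w + g p v w"
  using g_lincomb_left[of u p v w 1 1] by (simp add: tv_scale_def)

lemma g_scale_left: "u \<in> T p \<Longrightarrow> w \<in> T p \<Longrightarrow> g p (tv_scale a u) w = a * g p u w"
  using g_lincomb_left[of u p u w a 0] by (simp add: tv_scale_def tv_add_def)

lemma g_nondegenerate: "v \<in> T p \<Longrightarrow> (\<And>w. w \<in> T p \<Longrightarrow> g p v w = 0) \<Longrightarrow> v = tv_zero"
  using norden by (auto simp: almost_contact_norden_def pseudo_riemannian_metric_def)

lemma phi_scale: "v \<in> T p \<Longrightarrow> \<phi> p (tv_scale a v) = tv_scale a (\<phi> p v)"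
  using phi_lincomb[of v p v a 0] by (simp add: tv_scale_def tv_add_def)

lemma eta_scale: "v \<in> T p \<Longrightarrow> \<eta> p (tv_scale a v) = a * \<eta> p v"
  using eta_lincomb[of v p v a 0] by (simp add: tv_scale_def tv_add_def)

text \<open>Since phi^2 xi = 0, the formula for phi^2 applied to phi xi gives phi xi = a xi with a =
  eta(phi xi). Applying phi again gives a^2 xi = 0, and eta turns this into a^2 = 0.\<close>

lemma phi_xi: "\<phi> p (\<xi> p) = tv_zero"
proof -
  have zero: "tv_zero = tv_scale 0 v" for v :: "'m tvec"
    by (simp add: tv_zero_def tv_scale_def)
  define a where "a = \<eta> p (\<phi> p (\<xi> p))"
  have ff0: "\<phi> p (\<phi> p (\<xi> p)) = tv_zero"
    using phi_phi[OF xi_tangent] by (simp add: eta_xi tv_zero_def tv_add_def tv_scale_def)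
  then have "\<phi> p (\<phi> p (\<phi> p (\<xi> p))) = tv_zero"
    using phi_scale[OF xi_tangent, of p 0] by (metis zero)
  then have "tv_add (tv_scale (- 1) (\<phi> p (\<xi> p))) (tv_scale a (\<xi> p)) = tv_zero"
    using phi_phi[OF phi_tangent[OF xi_tangent], of p] by (simp add: a_def)
  then have *: "\<phi> p (\<xi> p) = tv_scale a (\<xi> p)"
    by (simp add: tv_zero_def tv_add_def tv_scale_def fun_eq_iff)
  then have "tv_zero = tv_scale (a * a) (\<xi> p)"
    using ff0 phi_scale[OF xi_tangent, of p a] by (simp add: tv_scale_def mult.assoc)
  then have "a * a = \<eta> p tv_zero"
    using eta_scale[OF xi_tangent, of p "a * a"] by (simp add: eta_xi)
  also have "\<dots> = 0"
    using eta_scale[OF xi_tangent, of p 0] by (metis zero mult_zero_left)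
  finally show ?thesis
    using * zero by simp
qed

lemma g_zero_right: "v \<in> T p \<Longrightarrow> g p v tv_zero = 0"
  using g_lincomb_right[OF xi_tangent xi_tangent, of v p 0 0]
  by (simp add: tv_zero_def tv_add_def tv_scale_def)

lemma g_zero_left: "w \<in> T p \<Longrightarrow> g p tv_zero w = 0"
  using g_scale_left[OF xi_tangent, of w p 0] by (simp add: tv_zero_def tv_scale_def)

lemma g_xi: "v \<in> T p \<Longrightarrow> g p v (\<xi> p) = \<eta> p v"
  using g_phi_phi[OF _ xi_tangent, of v p] by (simp add: phi_xi eta_xi g_zero_right phi_tangent)

text \<open>eta vanishes on the image of phi^2 because eta(xi) = 1. As phi xi = 0, phi^3 v = -phi v,
  so phi v lies in that image up to sign.\<close>

lemma eta_phi:
  assumes "v \<in> T p"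
  shows "\<eta> p (\<phi> p v) = 0"
proof -
  have v: "\<phi> p v \<in> T p" "\<phi> p (\<phi> p v) \<in> T p"
    using assms phi_tangent by blast+
  have "\<eta> p (\<phi> p (\<phi> p v)) = 0" if "v \<in> T p" for v
    using that by (simp add: phi_phi eta_lincomb xi_tangent eta_xi)
  then have "\<eta> p (\<phi> p (\<phi> p (\<phi> p v))) = 0"
    using v by blast
  moreover have "\<phi> p (\<phi> p (\<phi> p v)) = tv_add (tv_scale (-1) (\<phi> p v)) (tv_scale (\<eta> p v) tv_zero)"
    using assms by (simp add: phi_phi[OF assms] phi_lincomb xi_tangent phi_xi)
  \<comment> \<open>The zero vector is rewritten as a multiple of \<open>\<phi> p v\<close>, so that
    \<open>eta_lincomb\<close> applies with the same vector twice.\<close>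
  then have "\<phi> p (\<phi> p (\<phi> p v)) = tv_add (tv_scale (-1) (\<phi> p v)) (tv_scale 0 (\<phi> p v))"
    by (simp add: tv_zero_def tv_add_def tv_scale_def)
  ultimately show ?thesis
    using eta_lincomb[OF v(1) v(1), of "-1" 0] by simp
qed

text \<open>Put phi w for w in the compatibility of g with phi; the remaining eta terms contain
  eta(phi v) or eta(phi w) and vanish.\<close>

lemma g_phi_left:
  assumes "v \<in> T p" "w \<in> T p"
  shows "g p (\<phi> p v) w = g p v (\<phi> p w)"
  using g_phi_phi[OF assms(1) phi_tangent[OF assms(2)]] assms
  by (simp add: phi_phi g_lincomb_right phi_tangent xi_tangent eta_phi g_xi)

lemma cov_deriv_endo_vector_field:
  assumes "linear_connection A D" "V x" "V y"
  shows "V (cov_deriv_endo D \<phi> x y)"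
  unfolding cov_deriv_endo_def using assms structure_vector_field(2)
  by (intro vector_field_diff structure_vector_field(2)) (auto simp: linear_connection_def)

text \<open>Self-adjointness moves phi onto \<open>z\<close>, leaving only values of
  \<open>D\<close> itself. \<open>D\<close> is arbitrary so that the formula serves both
  \<open>nabla\<close> and \<open>nabla'\<close>.\<close>

lemma fundamental_tensor_eq:
  assumes "linear_connection A D" "V x" "V y" "V z"
  shows "fundamental_tensor \<phi> g D x y z p = g p (D x (f y) p) (z p) - g p (D x y p) (f z p)"
proof -
  have "V (D x y)" "V (D x (f y))"
    using assms structure_vector_field(2) unfolding linear_connection_def by blast+
  then have "g p (tv_add (D x (f y) p) (tv_scale (-1) (\<phi> p (D x y p)))) (z p) =
      g p (D x (f y) p) (z p) - g p (\<phi> p (D x y p)) (z p)"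
    using assms by (simp add: g_add_left g_scale_left V_tangent phi_tangent tangent_space_scale)
  then show ?thesis
    using \<open>V (D x y)\<close> \<open>V z\<close>
    by (simp add: fundamental_tensor_def cov_deriv_endo_def vf_diff_def vf_add_def vf_scale_def
        vf_map_def g_phi_left V_tangent)
qed

end

section \<open>Symmetries of F for the Levi-Civita connection\<close>

locale levi_civita_norden = norden_manifold A \<phi> \<xi> \<eta> g
  for A :: "('m::{t2_space,second_countable_topology}, 'e::euclidean_space) atlas"
    and \<phi> \<xi> \<eta> g +
  fixes nabla :: "'m vfield \<Rightarrow> 'm vfield \<Rightarrow> 'm vfield"
  assumes levi_civita: "levi_civita A g nabla"
begin

abbreviation F where "F \<equiv> fundamental_tensor \<phi> g nabla"

lemma nabla_linear_connection: "linear_connection A nabla"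
  using levi_civita by (simp add: levi_civita_def)

lemma nabla_vector_field: "V x \<Longrightarrow> V y \<Longrightarrow> V (nabla x y)"
  using nabla_linear_connection unfolding linear_connection_def by blast

lemma nabla_add_left: "V x \<Longrightarrow> V y \<Longrightarrow> V z \<Longrightarrow>
    nabla (vf_add x y) z = vf_add (nabla x z) (nabla y z)"
  using nabla_linear_connection unfolding linear_connection_def by blast

lemma nabla_add_right: "V x \<Longrightarrow> V y \<Longrightarrow> V z \<Longrightarrow>
    nabla x (vf_add y z) = vf_add (nabla x y) (nabla x z)"
  using nabla_linear_connection unfolding linear_connection_def by blast

lemma nabla_scale_left: "smooth_fun A u \<Longrightarrow> V x \<Longrightarrow> V y \<Longrightarrow>
    nabla (vf_scale u x) y = vf_scale u (nabla x y)"
  using nabla_linear_connection unfolding linear_connection_def by blast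

lemma nabla_scale_right: "smooth_fun A u \<Longrightarrow> V x \<Longrightarrow> V y \<Longrightarrow>
    nabla x (vf_scale u y) = vf_add (vf_scale (vf_apply x u) y) (vf_scale u (nabla x y))"
  using nabla_linear_connection unfolding linear_connection_def by blast

lemma nabla_metric: "V x \<Longrightarrow> V y \<Longrightarrow> V z \<Longrightarrow>
    vf_apply x (\<lambda>q. g q (y q) (z q)) p = g p (nabla x y p) (z p) + g p (y p) (nabla x z p)"
  using levi_civita unfolding levi_civita_def by blast

lemma f_f: "V y \<Longrightarrow> f (f y) = vf_add (vf_scale (\<lambda>p. - 1) y) (vf_scale (\<lambda>p. \<eta> p (y p)) \<xi>)"
  by (simp add: fun_eq_iff vf_map_def vf_add_def vf_scale_def phi_phi V_tangent)

lemma f_f_apply: "V y \<Longrightarrow> f (f y) p = tv_add (tv_scale (- 1) (y p)) (tv_scale (\<eta> p (y p)) (\<xi> p))"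
  by (simp add: vf_map_def phi_phi V_tangent)

lemma f_xi: "f \<xi> = vf_zero"
  by (simp add: fun_eq_iff vf_map_def vf_zero_def phi_xi)

lemma vf_zero_vector_field: "V vf_zero"
  using structure_vector_field(1,2) f_xi by metis

lemma nabla_zero_right:
  assumes "V x"
  shows "nabla x vf_zero = vf_zero"
proof -
  have "vf_add vf_zero vf_zero = (vf_zero :: 'm vfield)"
    by (simp add: vf_add_def vf_zero_def tv_add_def tv_zero_def)
  then have "nabla x vf_zero = vf_add (nabla x vf_zero) (nabla x vf_zero)"
    using nabla_add_right[OF assms vf_zero_vector_field vf_zero_vector_field] by simp
  then have "nabla x vf_zero p h = nabla x vf_zero p h + nabla x vf_zero p h" for p h
    by (metis tv_add_def vf_add_def)
  then show ?thesis
    by (simp add: fun_eq_iff vf_zero_def tv_zero_def)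
qed

text \<open>Deduced from additivity; the Leibniz rule would leave the derivative of the constant -1
  along \<open>x\<close> to be computed.\<close>

lemma nabla_uminus_right:
  assumes "V x" "V y"
  shows "nabla x (vf_scale (\<lambda>p. - 1) y) = vf_scale (\<lambda>p. - 1) (nabla x y)"
proof -
  have "vf_add (vf_scale (\<lambda>p. - 1) y) y = vf_zero"
    by (simp add: vf_add_def vf_zero_def tv_add_def tv_zero_def vf_scale_def tv_scale_def)
  then have "vf_add (nabla x (vf_scale (\<lambda>p. - 1) y)) (nabla x y) = vf_zero"
    using nabla_add_right[OF assms(1) _ assms(2), of "vf_scale (\<lambda>p. - 1) y"]
      nabla_zero_right[OF assms(1)] vector_field_scale[OF smooth_fun_const assms(2)] by metis
  then have "nabla x (vf_scale (\<lambda>p. - 1) y) p h + nabla x y p h = 0" for p h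
    by (metis tv_add_def vf_add_def vf_zero_def tv_zero_def)
  then show ?thesis
    by (simp add: fun_eq_iff vf_scale_def tv_scale_def eq_neg_iff_add_eq_0)
qed

lemma F_eq: "V x \<Longrightarrow> V y \<Longrightarrow> V z \<Longrightarrow>
    F x y z p = g p (nabla x (f y) p) (z p) - g p (nabla x y p) (f z p)"
  using fundamental_tensor_eq[OF nabla_linear_connection] .

text \<open>Differentiate g(phi y, z) = g(y, phi z) along \<open>x\<close> by metric compatibility
  and regroup the four terms.\<close>

lemma F_sym:
  assumes "V x" "V y" "V z"
  shows "F x y z p = F x z y p"
proof -
  have "(\<lambda>q. g q (f y q) (z q)) = (\<lambda>q. g q (y q) (f z q))"
    using assms by (simp add: vf_map_def g_phi_left V_tangent)
  then have "g p (nabla x (f y) p) (z p) + g p (f y p) (nabla x z p) =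
      g p (nabla x y p) (f z p) + g p (y p) (nabla x (f z) p)"
    using assms nabla_metric[of x "f y" z p] nabla_metric[of x y "f z" p]
    by (simp add: structure_vector_field)
  then show ?thesis
    using assms
    by (simp add: F_eq g_sym[of "y p"] g_sym[of "f y p"] V_tangent nabla_vector_field structure_vector_field)
qed

lemma F_f_f_left:
  assumes "V x" "V y" "V z"
  shows "F (f (f x)) y z p = - F x y z p + \<eta> p (x p) * F \<xi> y z p"
proof -
  have n: "nabla (f (f x)) w p =
      tv_add (tv_scale (- 1) (nabla x w p)) (tv_scale (\<eta> p (x p)) (nabla \<xi> w p))"
    if "V w" for w
  proof -
    have "nabla (f (f x)) w =
        vf_add (vf_scale (\<lambda>p. - 1) (nabla x w)) (vf_scale (\<lambda>p. \<eta> p (x p)) (nabla \<xi> w))"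
      using that assms
      by (simp add: f_f nabla_add_left nabla_scale_left vector_field_scale smooth_fun_const
          structure_vector_field)
    then show ?thesis
      by (simp add: vf_add_def vf_scale_def)
  qed
  show ?thesis
    using assms
    by (simp add: F_eq structure_vector_field n g_lincomb_left V_tangent nabla_vector_field algebra_simps)
qed

lemma F_f_f_right:
  assumes "V x" "V y" "V z"
  shows "F x y (f (f z)) p = - F x y z p + \<eta> p (z p) * F x y \<xi> p"
  using assms cov_deriv_endo_vector_field[OF nabla_linear_connection assms(1,2)]
  by (simp add: fundamental_tensor_def vf_map_def phi_phi V_tangent g_lincomb_right structure_vector_field)

text \<open>Expanding phi^2 y under the derivative produces a Leibniz term x(eta(y)) xi, which pairs
  to 0 with phi z. The rest regroups into values of \<open>F\<close>, because phi xi = 0 reduces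
  F(x, xi, z) to -g(nabla_x xi, phi z) and F(x, y, xi) to g(nabla_x (phi y), xi).\<close>

lemma F_f_f:
  assumes "V x" "V y" "V z"
  shows "F x (f y) (f z) p = F x y z p - \<eta> p (y p) * F x \<xi> z p - \<eta> p (z p) * F x y \<xi> p"
proof -
  have "nabla x (f (f y)) = vf_add (vf_scale (\<lambda>p. - 1) (nabla x y))
     (vf_add (vf_scale (vf_apply x (\<lambda>p. \<eta> p (y p))) \<xi>) (vf_scale (\<lambda>p. \<eta> p (y p)) (nabla x \<xi>)))"
    using assms
    by (simp add: f_f nabla_add_right nabla_uminus_right vector_field_scale smooth_fun_const
        structure_vector_field) (simp add: nabla_scale_right structure_vector_field)
  then have "nabla x (f (f y)) p = tv_add (tv_scale (- 1) (nabla x y p))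
     (tv_add (tv_scale (vf_apply x (\<lambda>p. \<eta> p (y p)) p) (\<xi> p)) (tv_scale (\<eta> p (y p)) (nabla x \<xi> p)))"
    by (simp add: vf_add_def vf_scale_def)
  then have "g p (nabla x (f (f y)) p) (f z p) =
      - g p (nabla x y p) (f z p) + \<eta> p (y p) * g p (nabla x \<xi> p) (f z p)"
    using assms
    by (simp add: g_add_left g_scale_left tangent_space_add tangent_space_scale V_tangent
        nabla_vector_field structure_vector_field g_sym[of "\<xi> p"] g_xi)
      (simp add: vf_map_def eta_phi V_tangent)
  moreover have "g p (nabla x (f y) p) (f (f z) p) =
      - g p (nabla x (f y) p) (z p) + \<eta> p (z p) * g p (nabla x (f y) p) (\<xi> p)"
    using assms
    by (simp add: f_f_apply V_tangent g_lincomb_right nabla_vector_field structure_vector_field)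
  ultimately show ?thesis
    using assms
    by (simp add: F_eq structure_vector_field f_xi nabla_zero_right)
      (simp add: vf_zero_def g_zero_left g_zero_right V_tangent nabla_vector_field
        algebra_simps)
qed

text \<open>At y = z = xi the identity \<open>F_f_f\<close> reads 0 = F - 2 F, since phi xi = 0 and
  eta(xi) = 1.\<close>

lemma F_xi_xi:
  assumes "V x"
  shows "F x \<xi> \<xi> p = 0"
proof -
  have "F x (f \<xi>) (f \<xi>) p = 0"
    using cov_deriv_endo_vector_field[OF nabla_linear_connection assms vf_zero_vector_field]
    by (simp only: f_xi) (simp add: fundamental_tensor_def vf_zero_def g_zero_right V_tangent)
  then show ?thesis
    using F_f_f[OF assms structure_vector_field(1) structure_vector_field(1), of p]
    by (simp add: eta_xi)
qed

text \<open>The abstract vectors become whole vector fields, while \<open>F\<close> and eta are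
  evaluated at the fixed point \<open>p\<close>.\<close>

lemma Q_tensor_phi:
  assumes "V x" "V y" "V z"
  shows "F x y z p + Q_tensor \<phi> \<xi> \<eta> g nabla t x (f y) z p = Q_tensor \<phi> \<xi> \<eta> g nabla t x y (f z) p"
proof -
  have "\<eta> p (f a p) = 0" if "V a" for a
    using that by (simp add: vf_map_def eta_phi V_tangent)
  then show ?thesis
    unfolding Q_tensor_def Let_def
    by (intro Q_phi_identity[where V = V and F = "\<lambda>x y z. F x y z p" and f = f and k = \<xi>
          and e = "\<lambda>x. \<eta> p (x p)"]
        assms structure_vector_field F_sym F_f_f_left F_f_f_right F_f_f F_xi_xi eta_xi)
qed

lemma almost_phi_connection_Q_tensor:
  assumes "linear_connection A nabla'"
    and Q: "\<And>x y z p. V x \<Longrightarrow> V y \<Longrightarrow> V z \<Longrightarrow>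
      g p (vf_diff (nabla' x y) (nabla x y) p) (z p) = Q_tensor \<phi> \<xi> \<eta> g nabla t x y z p"
  shows "almost_phi_connection A \<phi> nabla'"
  unfolding almost_phi_connection_def
proof (intro conjI allI impI ext)
  fix x y p h assume xy: "V x" "V y"
  have "V (nabla' a b)" if "V a" "V b" for a b
    using assms(1) that unfolding linear_connection_def by blast
  then have nabla': "g p (nabla' a b p) (c p) =
      g p (nabla a b p) (c p) + Q_tensor \<phi> \<xi> \<eta> g nabla t a b c p"
    if "V a" "V b" "V c" for a b c
    using Q[OF that, of p] that
    by (simp add: vf_diff_def vf_add_def vf_scale_def g_add_left g_scale_left tangent_space_scale
        V_tangent nabla_vector_field)
  have "cov_deriv_endo nabla' \<phi> x y p = tv_zero"
  proof (rule g_nondegenerate)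
    show "cov_deriv_endo nabla' \<phi> x y p \<in> T p"
      using cov_deriv_endo_vector_field[OF assms(1) xy] V_tangent by blast
    fix w assume "w \<in> T p"
    then obtain z where z: "V z" "z p = w"
      using tangent_vector_extension by blast
    \<comment> \<open>The hypothesis on Q is used at the triples (x, phi y, z) and (x, y, phi z);
      the \<open>nabla\<close> parts combine to \<open>F\<close>.\<close>
    have "fundamental_tensor \<phi> g nabla' x y z p =
        F x y z p + Q_tensor \<phi> \<xi> \<eta> g nabla t x (f y) z p
          - Q_tensor \<phi> \<xi> \<eta> g nabla t x y (f z) p"
      using xy z(1)
      by (simp add: fundamental_tensor_eq[OF assms(1)] nabla' F_eq structure_vector_field)
    also have "\<dots> = 0"
      using Q_tensor_phi[OF xy z(1)] by simp
    finally show "g p (cov_deriv_endo nabla' \<phi> x y p) w = 0"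
      using z(2) by (simp add: fundamental_tensor_def)
  qed
  then show "cov_deriv_endo nabla' \<phi> x y p h = vf_zero p h"
    by (simp add: vf_zero_def)
qed (rule assms(1))

end

theorem theorem2p1:
  fixes A :: "('m::{t2_space,second_countable_topology}, 'e::euclidean_space) atlas"
    and n :: nat
    and \<phi> :: "'m \<Rightarrow> 'm tvec \<Rightarrow> 'm tvec"
    and \<xi> :: "'m vfield"
    and \<eta> :: "'m \<Rightarrow> 'm tvec \<Rightarrow> real"
    and g :: "'m \<Rightarrow> 'm tvec \<Rightarrow> 'm tvec \<Rightarrow> real"
    and nabla nabla' :: "'m vfield \<Rightarrow> 'm vfield \<Rightarrow> 'm vfield"
    and t :: "nat \<Rightarrow> real"
  assumes "smooth_atlas A"
    and "DIM('e) = 2 * n + 1"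
    and "almost_contact_norden A \<phi> \<xi> \<eta> g"
    and "levi_civita A g nabla"
    and "linear_connection A nabla'"
    and "\<And>x y z p. vector_field A x \<Longrightarrow> vector_field A y \<Longrightarrow> vector_field A z \<Longrightarrow>
           g p (vf_diff (nabla' x y) (nabla x y) p) (z p) = Q_tensor \<phi> \<xi> \<eta> g nabla t x y z p"
  shows "almost_phi_connection A \<phi> nabla'"
proof -
  interpret levi_civita_norden A \<phi> \<xi> \<eta> g nabla
    using assms by unfold_locales
  show ?thesis
    using assms(5,6) by (rule almost_phi_connection_Q_tensor)
qed

end
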